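(* Let $X$ be an almost surely bounded, non-degenerate real random variable with mean $\mu=\mathbb{E}[X]$, and define $h:\mathbb{R}\to\mathbb{R}$ by $h(\lambda)=\frac{2}{\lambda^2}\ln\mathbb{E}[\exp(\lambda(X-\mu))]$ for $\lambda\neq0$ and $h(0)=\mathbb{V}[X]$. Then $X$ is strictly sub-Gaussian if and only if the maximum of $h$ is attained at zero, that is, $$\max_{\lambda\in\mathbb{R}}h(\lambda)=h(0)=\mathbb{V}[X].$$
   Context: A random variable $X$ with finite mean $\mu$ is $\sigma^2$-sub-Gaussian, with proxy variance $\sigma^2>0$, if $\mathbb{E}[\exp(\lambda(X-\mu))]\le \exp(\lambda^2\sigma^2/2)$ for all $\lambda\in\mathbb{R}$. The smallest such $\sigma^2$ is the optimal proxy variance $\sigma_{\mathrm{opt}}^2(X)$. One says that $X$ is strictly sub-Gaussian if $\sigma_{\mathrm{opt}}^2(X)=\mathbb{V}[X]$, where $\mathbb{V}[X]$ is the variance of $X$. Non-degenerate means not almost surely constant. *)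

theory Defs
  imports "HOL-Probability.Probability"
begin

context prob_space
begin

text \<open>
  The integrability conditions express that the mean is finite and that
  \<open>E[exp (l * (X - \<mu>))]\<close> is a genuine finite expectation: the Bochner integral of a
  non-integrable function is 0, so the inequality alone would hold vacuously for it.
\<close>

definition sub_gaussian :: "('a \<Rightarrow> real) \<Rightarrow> real \<Rightarrow> bool" where
  "sub_gaussian X s2 \<longleftrightarrow>
     s2 > 0 \<and> integrable M X \<and>
     (\<forall>l::real. integrable M (\<lambda>x. exp (l * (X x - expectation X))) \<and>
        expectation (\<lambda>x. exp (l * (X x - expectation X))) \<le> exp (l\<^sup>2 * s2 / 2))"

definition optimal_proxy_variance :: "('a \<Rightarrow> real) \<Rightarrow> real" where
  "optimal_proxy_variance X = (LEAST s2. sub_gaussian X s2)"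

text \<open>
  \<open>LEAST\<close> is unspecified if there is no smallest proxy variance (\<open>X\<close> is not
  sub-Gaussian, or is almost surely constant, where every \<open>s2 > 0\<close> is admissible).
  The first conjunct below excludes these cases; when the smallest proxy variance exists,
  it holds automatically.
\<close>

definition strictly_sub_gaussian :: "('a \<Rightarrow> real) \<Rightarrow> bool" where
  "strictly_sub_gaussian X \<longleftrightarrow>
     sub_gaussian X (optimal_proxy_variance X) \<and> optimal_proxy_variance X = variance X"

end

end

theory Submission
  imports Defs
begin

text \<open>
  A number \<open>s > 0\<close> is a proxy variance of \<open>X\<close> exactly when \<open>h l \<le> s\<close> for every \<open>l \<noteq> 0\<close>: this is
  the defining inequality after taking logarithms and dividing by \<open>l\<^sup>2 / 2\<close>. Hence \<open>h\<close> is maximal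
  at zero if and only if the variance itself is a proxy variance; positivity of the variance
  comes from nondegeneracy and the integrability conditions from boundedness.

  It remains to see that the variance, once it is a proxy variance, is automatically the optimal one,
  i.e. that it never exceeds any proxy variance (\<open>variance_le_if_sub_gaussian\<close>). This is the
  comparison of the second-order terms at \<open>l = 0\<close>. Averaging the sub-Gaussian inequality over
  \<open>l\<close> and \<open>- l\<close> removes the odd terms, and the elementary bound \<open>2 + u\<^sup>2 \<le> exp u + exp (- u)\<close> then
  gives the comparison without any estimate of a Taylor remainder under the integral.
\<close>

text \<open>
  The difference of the two sides is \<open>(2 sinh (u / 2))\<^sup>2 - u\<^sup>2\<close>, and \<open>\<bar>sinh v\<bar> \<ge> \<bar>v\<bar>\<close>.
\<close>

lemma two_plus_square_le_exp_plus_exp_minus: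
  fixes u :: real
  shows "2 + u\<^sup>2 \<le> exp u + exp (- u)"
proof -
  have "\<bar>u / 2\<bar> \<le> \<bar>(exp (u / 2) - inverse (exp (u / 2))) / 2\<bar>"
    by (rule real_le_abs_sinh)
  then have "\<bar>u\<bar> \<le> \<bar>exp (u / 2) - exp (- (u / 2))\<bar>"
    by (simp add: exp_minus)
  then have "u\<^sup>2 \<le> (exp (u / 2) - exp (- (u / 2)))\<^sup>2"
    by (simp add: abs_le_square_iff)
  also have "\<dots> = exp u + exp (- u) - 2"
    by (simp add: power2_diff flip: exp_double exp_add)
  finally show ?thesis by simp
qed

context prob_space
begin

text \<open>
  The averaged inequality reads \<open>1 + l\<^sup>2 * variance X / 2 \<le> exp (l\<^sup>2 * s / 2)\<close>; subtracting 1,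
  dividing by \<open>l\<^sup>2 / 2\<close> and letting \<open>l\<close> tend to zero leaves \<open>variance X \<le> s\<close>.
\<close>

lemma variance_le_if_sub_gaussian:
  assumes sg: "sub_gaussian X s"
  shows "variance X \<le> s"
proof -
  define Y where "Y = (\<lambda>x. X x - expectation X)"
  have [measurable]: "Y \<in> borel_measurable M"
    using sg by (auto simp: sub_gaussian_def Y_def)
  have int: "integrable M (\<lambda>x. exp (l * Y x))"
    and le: "expectation (\<lambda>x. exp (l * Y x)) \<le> exp (l\<^sup>2 * s / 2)" for l
    using sg by (auto simp: sub_gaussian_def Y_def)
  have int_square: "integrable M (\<lambda>x. (Y x)\<^sup>2)"
  proof (rule Bochner_Integration.integrable_bound)
    show "integrable M (\<lambda>x. exp (1 * Y x) + exp ((- 1) * Y x))"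
      by (intro Bochner_Integration.integrable_add int)
    have "(Y x)\<^sup>2 \<le> exp (Y x) + exp (- Y x)" for x
      using two_plus_square_le_exp_plus_exp_minus[of "Y x"] by linarith
    then show "AE x in M. norm ((Y x)\<^sup>2) \<le> norm (exp (1 * Y x) + exp ((- 1) * Y x))"
      by simp
  qed simp
  have averaged: "2 + l\<^sup>2 * variance X \<le> 2 * exp (l\<^sup>2 * s / 2)" for l
  proof -
    have "2 + l\<^sup>2 * variance X = expectation (\<lambda>x. 2 + l\<^sup>2 * (Y x)\<^sup>2)"
      using int_square by (simp add: Y_def prob_space)
    also have "\<dots> \<le> expectation (\<lambda>x. exp (l * Y x) + exp ((- l) * Y x))"
    proof (rule integral_mono)
      show "integrable M (\<lambda>x. 2 + l\<^sup>2 * (Y x)\<^sup>2)"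
        using int_square by simp
      show "integrable M (\<lambda>x. exp (l * Y x) + exp ((- l) * Y x))"
        by (intro Bochner_Integration.integrable_add int)
      show "2 + l\<^sup>2 * (Y x)\<^sup>2 \<le> exp (l * Y x) + exp ((- l) * Y x)" for x
        using two_plus_square_le_exp_plus_exp_minus[of "l * Y x"] by (simp add: power_mult_distrib)
    qed
    also have "\<dots> = expectation (\<lambda>x. exp (l * Y x)) + expectation (\<lambda>x. exp ((- l) * Y x))"
      by (intro Bochner_Integration.integral_add int)
    also have "\<dots> \<le> 2 * exp (l\<^sup>2 * s / 2)"
      using le[of l] le[of "- l"] by simp
    finally show ?thesis .
  qed
  \<comment> \<open>The limit is taken in \<open>t = l\<^sup>2 / 2\<close>, where it is the derivative of \<open>\<lambda>t. exp (s * t)\<close> at 0.\<close>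
  have bound: "variance X \<le> (exp (s * t) - 1) / t" if "t > 0" for t
    using averaged[of "sqrt (2 * t)"] that by (simp add: field_simps)
  have "((\<lambda>t. exp (s * t)) has_real_derivative s) (at 0)"
    by (auto intro!: derivative_eq_intros)
  then have lim: "((\<lambda>t. (exp (s * t) - 1) / t) \<longlongrightarrow> s) (at_right 0)"
    by (auto simp: has_field_derivative_iff intro: tendsto_within_subset)
  show ?thesis
  proof (rule tendsto_lowerbound[OF lim])
    show "\<forall>\<^sub>F t in at_right 0. variance X \<le> (exp (s * t) - 1) / t"
      using bound by (auto simp: eventually_at_filter)
  qed simp
qed

lemma strictly_sub_gaussian_iff_sub_gaussian_variance:
  "strictly_sub_gaussian X \<longleftrightarrow> sub_gaussian X (variance X)"
proof
  assume "sub_gaussian X (variance X)"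
  moreover from this have "optimal_proxy_variance X = variance X"
    unfolding optimal_proxy_variance_def
    by (intro Least_equality variance_le_if_sub_gaussian)
  ultimately show "strictly_sub_gaussian X"
    by (simp add: strictly_sub_gaussian_def)
next
  assume "strictly_sub_gaussian X"
  then show "sub_gaussian X (variance X)"
    unfolding strictly_sub_gaussian_def by metis
qed

lemma integrable_exp_of_AE_bounded:
  fixes Y :: "'a \<Rightarrow> real"
  assumes [measurable]: "Y \<in> borel_measurable M" and "AE x in M. \<bar>Y x\<bar> \<le> K"
  shows "integrable M (\<lambda>x. exp (l * Y x))"
proof (rule integrable_const_bound)
  show "AE x in M. norm (exp (l * Y x)) \<le> exp (\<bar>l\<bar> * K)"
    using assms(2)
  proof eventually_elim
    case (elim x)
    have "l * Y x \<le> \<bar>l\<bar> * \<bar>Y x\<bar>"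
      by (metis abs_ge_self abs_mult)
    also have "\<dots> \<le> \<bar>l\<bar> * K"
      using elim by (intro mult_left_mono) auto
    finally show ?case by simp
  qed
qed simp

lemma variance_pos_if_nondegenerate:
  fixes X :: "'a \<Rightarrow> real"
  assumes "integrable M (\<lambda>x. (X x - expectation X)\<^sup>2)"
    and "\<not> (\<exists>c. AE x in M. X x = c)"
  shows "variance X > 0"
proof -
  have "variance X \<noteq> 0"
  proof
    assume "variance X = 0"
    with assms(1) have "AE x in M. (X x - expectation X)\<^sup>2 = 0"
      using integral_nonneg_eq_0_iff_AE[OF assms(1)] by simp
    then have "AE x in M. X x = expectation X" by simp
    with assms(2) show False by blast
  qed
  then show ?thesis
    using variance_positive[of X] by linarith
qed

text \<open>
  Taking logarithms needs a positive moment generating function; for a centred variable it is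
  even at least 1, by \<open>exp u \<ge> 1 + u\<close>.
\<close>

lemma expectation_exp_centred_ge_1:
  fixes X :: "'a \<Rightarrow> real"
  assumes "integrable M X" and "integrable M (\<lambda>x. exp (l * (X x - expectation X)))"
  shows "1 \<le> expectation (\<lambda>x. exp (l * (X x - expectation X)))"
proof -
  have "1 = expectation (\<lambda>x. 1 + l * (X x - expectation X))"
    using assms(1) by (simp add: prob_space)
  also have "\<dots> \<le> expectation (\<lambda>x. exp (l * (X x - expectation X)))"
    using assms by (intro integral_mono) (auto intro: exp_ge_add_one_self)
  finally show ?thesis .
qed

end

lemma scaled_ln_le_iff_le_exp:
  fixes l m s :: real
  assumes "l \<noteq> 0" and "m > 0"
  shows "2 / l\<^sup>2 * ln m \<le> s \<longleftrightarrow> m \<le> exp (l\<^sup>2 * s / 2)"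
proof -
  have "2 / l\<^sup>2 * ln m \<le> s \<longleftrightarrow> ln m \<le> l\<^sup>2 * s / 2"
    using assms(1) by (simp add: field_simps)
  also have "\<dots> \<longleftrightarrow> m \<le> exp (l\<^sup>2 * s / 2)"
    using assms(2) by (metis exp_le_cancel_iff exp_ln)
  finally show ?thesis .
qed

theorem corollary3p1:
  fixes M :: "'a measure" and X :: "'a \<Rightarrow> real" and \<mu> :: real and h :: "real \<Rightarrow> real"
  assumes "prob_space M"
    and "X \<in> borel_measurable M"
    and bounded: "\<exists>C. AE x in M. \<bar>X x\<bar> \<le> C"
    and nondegenerate: "\<not> (\<exists>c. AE x in M. X x = c)"
    and mu: "\<mu> = prob_space.expectation M X"
    and h_nonzero: "\<And>l. l \<noteq> 0 \<Longrightarrow>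
      h l = 2 / l\<^sup>2 * ln (prob_space.expectation M (\<lambda>x. exp (l * (X x - \<mu>))))"
    and h_zero: "h 0 = prob_space.variance M X"
  shows "prob_space.strictly_sub_gaussian M X \<longleftrightarrow>
    (\<forall>l. h l \<le> h 0) \<and> h 0 = prob_space.variance M X"
proof -
  interpret prob_space M by fact
  have [measurable]: "X \<in> borel_measurable M" by fact
  obtain C where C: "AE x in M. \<bar>X x\<bar> \<le> C" using bounded by blast
  have intX: "integrable M X"
    using C by (intro integrable_const_bound[of _ C]) auto
  have AE_Y: "AE x in M. \<bar>X x - \<mu>\<bar> \<le> C + \<bar>\<mu>\<bar>"
    using C by eventually_elim linarith
  have int_exp: "integrable M (\<lambda>x. exp (l * (X x - \<mu>)))" for l
    using AE_Y by (intro integrable_exp_of_AE_bounded) auto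
  have "AE x in M. norm ((X x - \<mu>)\<^sup>2) \<le> (C + \<bar>\<mu>\<bar>)\<^sup>2"
    using AE_Y by eventually_elim (auto simp: abs_le_square_iff[symmetric])
  then have "integrable M (\<lambda>x. (X x - \<mu>)\<^sup>2)"
    by (intro integrable_const_bound) auto
  then have var_pos: "variance X > 0"
    using nondegenerate by (intro variance_pos_if_nondegenerate) (auto simp: mu)
  have mgf_pos: "0 < expectation (\<lambda>x. exp (l * (X x - \<mu>)))" for l
    using expectation_exp_centred_ge_1[OF intX, of l] int_exp[of l] by (simp add: mu)
  have h_le_iff: "h l \<le> h 0 \<longleftrightarrow>
      expectation (\<lambda>x. exp (l * (X x - \<mu>))) \<le> exp (l\<^sup>2 * variance X / 2)" for l
  proof (cases "l = 0")
    case False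
    then show ?thesis
      unfolding h_nonzero[OF False] h_zero by (intro scaled_ln_le_iff_le_exp mgf_pos)
  qed (simp add: prob_space)
  have "strictly_sub_gaussian X \<longleftrightarrow> sub_gaussian X (variance X)"
    by (rule strictly_sub_gaussian_iff_sub_gaussian_variance)
  also have "\<dots> \<longleftrightarrow> (\<forall>l. h l \<le> h 0)"
    using var_pos intX int_exp unfolding sub_gaussian_def h_le_iff by (simp add: mu)
  finally show ?thesis
    using h_zero by simp
qed

end
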